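(* Let $G$ be a residually finite group, let $H \leqslant G$ be a finitely generated virtually abelian subgroup which is a virtual retract of $G$, and let $A \leqslant G$ be any subgroup containing $H$ with finite index. Then $A$ is a virtual retract of $G$.
   Context: A subgroup $H$ of a group $K$ is a retract of $K$ if there is a homomorphism $\rho: K \to H$ which restricts to the identity map on $H$. A subgroup $H$ of a group $G$ is a virtual retract of $G$ if there exists a subgroup $K \leqslant G$ with $|G:K|<\infty$, $H \subseteq K$, and $H$ a retract of $K$. A group is virtually abelian if it has an abelian subgroup of finite index. *)

theory Defs
  imports "HOL-Algebra.Algebra"
begin

text \<open>
  A subgroup \<open>H\<close> of \<open>G\<close>, regarded as a group, is \<open>G\<lparr>carrier := H\<rparr>\<close>; the index \<open>|G : H|\<close> is the
  number of right cosets. The index is never taken as a cardinality below, since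
  \<open>card\<close> of an infinite set is \<open>0\<close>.
\<close>

definition finite_index_subgroup :: "'a set \<Rightarrow> ('a, 'b) monoid_scheme \<Rightarrow> bool" where
  "finite_index_subgroup H G \<longleftrightarrow> subgroup H G \<and> finite (rcosets\<^bsub>G\<^esub> H)"

definition residually_finite :: "('a, 'b) monoid_scheme \<Rightarrow> bool" where
  "residually_finite G \<longleftrightarrow>
     (\<forall>g\<in>carrier G. g \<noteq> \<one>\<^bsub>G\<^esub> \<longrightarrow> (\<exists>N. N \<lhd> G \<and> finite_index_subgroup N G \<and> g \<notin> N))"

definition finitely_generated_group :: "('a, 'b) monoid_scheme \<Rightarrow> bool" where
  "finitely_generated_group G \<longleftrightarrow>
     (\<exists>S. finite S \<and> S \<subseteq> carrier G \<and> generate G S = carrier G)"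

definition virtually_abelian :: "('a, 'b) monoid_scheme \<Rightarrow> bool" where
  "virtually_abelian G \<longleftrightarrow>
     (\<exists>B. finite_index_subgroup B G \<and> comm_group (G\<lparr>carrier := B\<rparr>))"

definition group_retract :: "'a set \<Rightarrow> ('a, 'b) monoid_scheme \<Rightarrow> bool" where
  "group_retract H K \<longleftrightarrow>
     subgroup H K \<and> (\<exists>\<rho>\<in>hom K (K\<lparr>carrier := H\<rparr>). \<forall>h\<in>H. \<rho> h = h)"

definition virtual_retract :: "'a set \<Rightarrow> ('a, 'b) monoid_scheme \<Rightarrow> bool" where
  "virtual_retract H G \<longleftrightarrow>
     subgroup H G \<and>
     (\<exists>K. finite_index_subgroup K G \<and> H \<subseteq> K \<and> group_retract H (G\<lparr>carrier := K\<rparr>))"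

end

theory Submission
  imports Defs
begin

text \<open>
  Choose an abelian \<open>Z \<le> H\<close> of finite index that is normal in \<open>A\<close>. The retraction onto \<open>H\<close> restricts to a
  retraction onto \<open>Z\<close> of some finite index subgroup of \<open>G\<close>, and the core \<open>K\<close> of that subgroup under conjugation by
  \<open>A\<close> still contains \<open>Z\<close>. Multiplying the conjugates of the retraction by representatives of the \<open>m\<close>
  cosets of \<open>Z\<close> in \<open>A\<close> gives an \<open>A\<close>-equivariant homomorphism \<open>\<phi> : K \<rightarrow> Z\<close> with \<open>\<phi> z = z ^ m\<close> on \<open>Z\<close>. As
  \<open>Z\<close> is finitely generated, \<open>Z ^ m\<close> has finite index in \<open>Z\<close> and the \<open>m\<close>-torsion of \<open>Z\<close> is finite; hence the kernel
  \<open>N\<close> of \<open>\<phi>\<close>, which \<open>A\<close> normalises, has finite intersection with \<open>A\<close>, and \<open>A N\<close> has finite index in \<open>G\<close>.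
  Residual finiteness provides a normal finite index subgroup \<open>M\<close> of \<open>G\<close> with \<open>M \<inter> N \<inter> A = 1\<close>,
  and then \<open>A (M \<inter> N)\<close> is a semidirect product which has finite index and retracts onto \<open>A\<close>.
\<close>

section \<open>Finite index\<close>

text \<open>For a subgroup \<open>H\<close> of \<open>L\<close> this says that the index is finite; arbitrary sets are allowed so
  that products such as \<open>A <#> N\<close> need not be shown to be subgroups.\<close>

definition finitely_covers :: "('a, 'b) monoid_scheme \<Rightarrow> 'a set \<Rightarrow> 'a set \<Rightarrow> bool" where
  "finitely_covers G H L \<longleftrightarrow> (\<exists>T. finite T \<and> T \<subseteq> carrier G \<and> L \<subseteq> H <#>\<^bsub>G\<^esub> T)"

lemma finitely_covers_carrier_update:
  "finitely_covers (G\<lparr>carrier := M\<rparr>) H L \<longleftrightarrow> (\<exists>T. finite T \<and> T \<subseteq> M \<and> L \<subseteq> H <#>\<^bsub>G\<^esub> T)"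
  by (simp add: finitely_covers_def set_mult_def)

context group
begin

lemma mult_inv_cancel_left:
  assumes "x \<in> carrier G" "y \<in> carrier G"
  shows "x \<otimes> (inv x \<otimes> y) = y" "inv x \<otimes> (x \<otimes> y) = y"
  using assms by (simp_all flip: m_assoc)

lemmas group_word_simps = m_assoc inv_mult_group mult_inv_cancel_left

text \<open>A coset is represented by any of its elements. Each \<open>t\<close> whose coset
  \<open>H #> t\<close> meets \<open>L\<close> is exchanged for an element of \<open>L\<close> in
  that coset, and the other \<open>t\<close> are dropped.\<close>

lemma finitely_covers_representatives:
  assumes "finitely_covers G H L" "subgroup H G" "L \<subseteq> carrier G"
  obtains T where "finite T" "T \<subseteq> L" "L \<subseteq> H <#> T"
proof -
  obtain T where T: "finite T" "T \<subseteq> carrier G" "L \<subseteq> H <#> T"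
    using assms(1) unfolding finitely_covers_def by blast
  define T0 where "T0 = {t \<in> T. \<exists>l\<in>L. \<exists>h\<in>H. l = h \<otimes> t}"
  define r where "r t = (SOME l. l \<in> L \<and> (\<exists>h\<in>H. l = h \<otimes> t))" for t
  have r: "r t \<in> L \<and> (\<exists>h\<in>H. r t = h \<otimes> t)" if "t \<in> T0" for t
    unfolding r_def by (rule someI_ex) (use that in \<open>auto simp: T0_def\<close>)
  show thesis
  proof
    show "finite (r ` T0)" using T(1) by (simp add: T0_def)
    show "r ` T0 \<subseteq> L" using r by auto
    show "L \<subseteq> H <#> r ` T0"
    proof
      fix l assume l: "l \<in> L"
      then obtain h t where ht: "h \<in> H" "t \<in> T" "l = h \<otimes> t"
        using T(3) by (auto simp: set_mult_def)
      then have t: "t \<in> T0" using l by (auto simp: T0_def)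
      then obtain h' where h': "h' \<in> H" "r t = h' \<otimes> t" using r by blast
      have c: "h \<in> carrier G" "h' \<in> carrier G" "t \<in> carrier G"
        using ht(1,2) h'(1) T(2) subgroup.subset[OF assms(2)] by auto
      have "l = (h \<otimes> inv h') \<otimes> r t"
        using c by (simp add: ht(3) h'(2) group_word_simps)
      moreover have "h \<otimes> inv h' \<in> H"
        using assms(2) ht(1) h'(1) by (simp add: subgroup.m_closed subgroup.m_inv_closed)
      ultimately show "l \<in> H <#> r ` T0" using t unfolding set_mult_def by blast
    qed
  qed
qed

lemma finitely_covers_mono:
  assumes "finitely_covers G H L" "H \<subseteq> H'" "L' \<subseteq> L"
  shows "finitely_covers G H' L'"
proof -
  obtain T where T: "finite T" "T \<subseteq> carrier G" "L \<subseteq> H <#> T"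
    using assms(1) unfolding finitely_covers_def by blast
  have "L' \<subseteq> L" by (fact assms(3))
  also note T(3)
  also have "H <#> T \<subseteq> H' <#> T" using assms(2) by (rule mono_set_mult) simp
  finally show ?thesis using T(1,2) unfolding finitely_covers_def by blast
qed

text \<open>Representatives of the two stages multiply, as for the index in a chain of
  subgroups.\<close>

lemma finitely_covers_trans:
  assumes "finitely_covers G H L" "finitely_covers G L M" "H \<subseteq> carrier G"
  shows "finitely_covers G H M"
proof -
  obtain T where T: "finite T" "T \<subseteq> carrier G" "L \<subseteq> H <#> T"
    using assms(1) unfolding finitely_covers_def by blast
  obtain S where S: "finite S" "S \<subseteq> carrier G" "M \<subseteq> L <#> S"
    using assms(2) unfolding finitely_covers_def by blast
  have "M \<subseteq> (H <#> T) <#> S"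
    using S(3) mono_set_mult[OF T(3) order.refl] by (rule order.trans)
  also have "\<dots> = H <#> (T <#> S)"
    using set_mult_assoc[OF assms(3) T(2) S(2)] .
  finally have "M \<subseteq> H <#> (T <#> S)" .
  moreover have "finite (T <#> S)"
    using T(1) S(1) by (simp add: set_mult_def)
  moreover have "T <#> S \<subseteq> carrier G"
    using T(2) S(2) by (rule set_mult_closed)
  ultimately show ?thesis unfolding finitely_covers_def by blast
qed

lemma finite_rcosets_iff_finitely_covers:
  assumes "subgroup H G"
  shows "finite (rcosets H) \<longleftrightarrow> finitely_covers G H (carrier G)"
proof
  assume "finite (rcosets H)"
  then have "finite ((\<lambda>a. H #> a) ` carrier G)"
    by (simp add: RCOSETS_def UNION_singleton_eq_range)
  then obtain T where T: "T \<subseteq> carrier G" "finite T"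
    "(\<lambda>a. H #> a) ` carrier G = (\<lambda>a. H #> a) ` T"
    using finite_subset_image[of "(\<lambda>a. H #> a) ` carrier G" "\<lambda>a. H #> a" "carrier G"] by auto
  have "carrier G \<subseteq> H <#> T"
  proof
    fix a assume a: "a \<in> carrier G"
    then obtain t where "t \<in> T" "H #> a = H #> t" using T(3) by blast
    moreover have "a \<in> H #> a" using a assms by (rule rcos_self)
    ultimately show "a \<in> H <#> T" by (auto simp: r_coset_def set_mult_def)
  qed
  then show "finitely_covers G H (carrier G)" using T unfolding finitely_covers_def by blast
next
  assume "finitely_covers G H (carrier G)"
  then obtain T where T: "finite T" "T \<subseteq> carrier G" "carrier G \<subseteq> H <#> T"
    unfolding finitely_covers_def by blast
  have "rcosets H \<subseteq> (\<lambda>a. H #> a) ` T"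
  proof
    fix c assume "c \<in> rcosets H"
    then obtain a where a: "a \<in> carrier G" "c = H #> a" by (auto simp: RCOSETS_def)
    then obtain h t where "h \<in> H" "t \<in> T" "a = h \<otimes> t" using T(3) by (auto simp: set_mult_def)
    then have "a \<in> H #> t" "t \<in> T" by (auto simp: r_coset_def)
    then show "c \<in> (\<lambda>a. H #> a) ` T"
      using a(2) T(2) repr_independence[of a H t] assms by auto
  qed
  then show "finite (rcosets H)" using T(1) by (meson finite_imageI finite_subset)
qed

text \<open>Covering in \<open>G\<close> allows representatives anywhere in \<open>G\<close>,
  whereas the index in \<open>L\<close> asks for representatives in \<open>L\<close>;
  \<open>finitely_covers_representatives\<close> closes this gap.\<close>

lemma finite_index_subgroup_iff_finitely_covers:
  assumes "subgroup L G"
  shows "finite_index_subgroup H (G\<lparr>carrier := L\<rparr>) \<longleftrightarrow>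
    subgroup H G \<and> H \<subseteq> L \<and> finitely_covers G H L"
proof -
  interpret L: group "G\<lparr>carrier := L\<rparr>" using assms by (rule subgroup_imp_group)
  have sub: "subgroup H (G\<lparr>carrier := L\<rparr>) \<longleftrightarrow> subgroup H G \<and> H \<subseteq> L"
  proof
    assume "subgroup H (G\<lparr>carrier := L\<rparr>)"
    then show "subgroup H G \<and> H \<subseteq> L"
      using incl_subgroup[OF assms, of H] subgroup.subset[of H "G\<lparr>carrier := L\<rparr>"] by simp
  next
    assume "subgroup H G \<and> H \<subseteq> L"
    then show "subgroup H (G\<lparr>carrier := L\<rparr>)" using subgroup_incl assms by blast
  qed
  have "finitely_covers (G\<lparr>carrier := L\<rparr>) H L \<longleftrightarrow> finitely_covers G H L" if "subgroup H G" "H \<subseteq> L"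
  proof
    assume "finitely_covers (G\<lparr>carrier := L\<rparr>) H L"
    then show "finitely_covers G H L"
      unfolding finitely_covers_carrier_update using subgroup.subset[OF assms]
      by (auto simp: finitely_covers_def)
  next
    assume "finitely_covers G H L"
    from finitely_covers_representatives[OF this that(1) subgroup.subset[OF assms]]
    show "finitely_covers (G\<lparr>carrier := L\<rparr>) H L"
      unfolding finitely_covers_carrier_update by metis
  qed
  then show ?thesis
    using sub L.finite_rcosets_iff_finitely_covers[of H] unfolding finite_index_subgroup_def
    by auto
qed

text \<open>The map is given only by its values on \<open>M\<close>, so that retractions,
  conjugations and inclusions can be inserted directly. It is viewed as a \<open>group_hom\<close>
  just to obtain compatibility with inverses.\<close>

lemma subgroup_vimage:
  assumes M: "subgroup M G" and W: "subgroup W G"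
    and f: "f \<in> M \<rightarrow> carrier G" "\<And>x y. x \<in> M \<Longrightarrow> y \<in> M \<Longrightarrow> f (x \<otimes> y) = f x \<otimes> f y"
  shows "subgroup {x \<in> M. f x \<in> W} G"
proof -
  interpret M: subgroup M G by fact
  have "f \<in> hom (G\<lparr>carrier := M\<rparr>) G" using f by (auto simp: hom_def)
  then interpret f: group_hom "G\<lparr>carrier := M\<rparr>" G f
    by (simp add: group_hom_def group_hom_axioms_def M.subgroup_is_group is_group)
  have inv: "f (inv x) = inv (f x)" if "x \<in> M" for x
    using f.hom_inv[of x] that M by simp
  show ?thesis
  proof (rule subgroupI)
    have "f \<one> \<in> W" using f.hom_one subgroup.one_closed[OF W] by simp
    then show "{x \<in> M. f x \<in> W} \<noteq> {}" using M.one_closed by blast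
  qed (auto simp: f(2) inv intro: subgroup.m_closed[OF W] subgroup.m_inv_closed[OF W])
qed

lemma finitely_covers_vimage:
  assumes M: "subgroup M G" and W: "subgroup W G"
    and f: "f \<in> M \<rightarrow> carrier G" "\<And>x y. x \<in> M \<Longrightarrow> y \<in> M \<Longrightarrow> f (x \<otimes> y) = f x \<otimes> f y"
    and cov: "finitely_covers G W (f ` M)"
  shows "finitely_covers G {x \<in> M. f x \<in> W} M"
proof -
  have fM: "f ` M \<subseteq> carrier G" using f(1) by auto
  obtain T where T: "finite T" "T \<subseteq> f ` M" "f ` M \<subseteq> W <#> T"
    using finitely_covers_representatives[OF cov W fM] .
  then obtain S where S: "S \<subseteq> M" "finite S" "T = f ` S"
    using finite_subset_image by metis
  have "M \<subseteq> {x \<in> M. f x \<in> W} <#> S"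
  proof
    fix x assume x: "x \<in> M"
    then obtain w s where ws: "w \<in> W" "s \<in> S" "f x = w \<otimes> f s"
      using T(3) S(3) by (force simp: set_mult_def)
    have sM: "s \<in> M" using ws(2) S(1) by auto
    have c: "x \<in> carrier G" "s \<in> carrier G" "w \<in> carrier G" "f x \<in> carrier G" "f s \<in> carrier G"
      using x sM ws(1) f(1) subgroup.subset[OF M] subgroup.subset[OF W] by auto
    have y: "x \<otimes> inv s \<in> M" using x sM M by (simp add: subgroup.m_closed subgroup.m_inv_closed)
    have "f (x \<otimes> inv s) \<otimes> f s = f x"
      using f(2)[OF y sM] c by (simp add: group_word_simps)
    then have "f (x \<otimes> inv s) = w"
      using ws(3) c f(1) y by (metis PiE r_cancel)
    then have "x \<otimes> inv s \<in> {x \<in> M. f x \<in> W}" using y ws(1) by simp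
    moreover have "x = (x \<otimes> inv s) \<otimes> s" using c by (simp add: group_word_simps)
    ultimately show "x \<in> {x \<in> M. f x \<in> W} <#> S" using ws(2) unfolding set_mult_def by blast
  qed
  moreover have "S \<subseteq> carrier G" using S(1) subgroup.subset[OF M] by auto
  ultimately show ?thesis using S(2) unfolding finitely_covers_def by blast
qed

lemma finitely_covers_Int:
  assumes "subgroup M G" "subgroup W G" "finitely_covers G W M"
  shows "finitely_covers G (W \<inter> M) M"
proof -
  \<comment> \<open>The intersection is the preimage of \<open>W\<close> under the inclusion of
    \<open>M\<close>.\<close>
  have "finitely_covers G {x \<in> M. x \<in> W} M"
    using assms subgroup.subset[OF assms(1)] by (intro finitely_covers_vimage) auto
  moreover have "{x \<in> M. x \<in> W} = W \<inter> M" by auto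
  ultimately show ?thesis by simp
qed

section \<open>Cores: intersections of conjugates of a subgroup\<close>

lemma subgroup_conj_core:
  assumes "subgroup M G" "subgroup K G" "A \<subseteq> carrier G"
  shows "subgroup {x \<in> M. \<forall>a\<in>A. a \<otimes> x \<otimes> inv a \<in> K} G"
proof (rule subgroupI)
  interpret M: subgroup M G by fact
  interpret K: subgroup K G by fact
  show "{x \<in> M. \<forall>a\<in>A. a \<otimes> x \<otimes> inv a \<in> K} \<subseteq> carrier G" by auto
  have "\<one> \<in> {x \<in> M. \<forall>a\<in>A. a \<otimes> x \<otimes> inv a \<in> K}" using assms(3) by auto
  then show "{x \<in> M. \<forall>a\<in>A. a \<otimes> x \<otimes> inv a \<in> K} \<noteq> {}" by blast
  fix x assume x: "x \<in> {x \<in> M. \<forall>a\<in>A. a \<otimes> x \<otimes> inv a \<in> K}"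
  have "a \<otimes> inv x \<otimes> inv a \<in> K" if "a \<in> A" for a
  proof -
    have "inv (a \<otimes> x \<otimes> inv a) \<in> K" using that x by (intro K.m_inv_closed) auto
    moreover have "a \<in> carrier G" using that assms(3) by auto
    ultimately show ?thesis using x by (simp add: group_word_simps)
  qed
  then show "inv x \<in> {x \<in> M. \<forall>a\<in>A. a \<otimes> x \<otimes> inv a \<in> K}" using x by auto
  fix y assume y: "y \<in> {x \<in> M. \<forall>a\<in>A. a \<otimes> x \<otimes> inv a \<in> K}"
  have "a \<otimes> (x \<otimes> y) \<otimes> inv a \<in> K" if "a \<in> A" for a
  proof -
    have "(a \<otimes> x \<otimes> inv a) \<otimes> (a \<otimes> y \<otimes> inv a) \<in> K" by (rule K.m_closed) (use that x y in auto)
    moreover have "a \<in> carrier G" using that assms(3) by auto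
    ultimately show ?thesis using x y by (simp add: group_word_simps)
  qed
  then show "x \<otimes> y \<in> {x \<in> M. \<forall>a\<in>A. a \<otimes> x \<otimes> inv a \<in> K}" using x y by auto
qed

lemma conj_core_subset:
  assumes "M \<subseteq> carrier G" "\<one> \<in> A"
  shows "{x \<in> M. \<forall>a\<in>A. a \<otimes> x \<otimes> inv a \<in> K} \<subseteq> K"
proof
  fix x assume x: "x \<in> {x \<in> M. \<forall>a\<in>A. a \<otimes> x \<otimes> inv a \<in> K}"
  then have "\<one> \<otimes> x \<otimes> inv \<one> \<in> K" using assms(2) by blast
  moreover have "x \<in> carrier G" using x assms(1) by auto
  ultimately show "x \<in> K" by simp
qed

text \<open>Conjugating by \<open>a\<close> and then by \<open>b\<close> is conjugating by
  \<open>b \<otimes> a\<close>, which is again in \<open>A\<close>.\<close>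

lemma conj_core_invariant:
  assumes A: "subgroup A G" "A \<subseteq> M" and M: "subgroup M G"
    and x: "x \<in> {x \<in> M. \<forall>a\<in>A. a \<otimes> x \<otimes> inv a \<in> K}" and a: "a \<in> A"
  shows "a \<otimes> x \<otimes> inv a \<in> {x \<in> M. \<forall>a\<in>A. a \<otimes> x \<otimes> inv a \<in> K}"
proof -
  interpret A: subgroup A G by fact
  interpret M: subgroup M G by fact
  have xM: "x \<in> M" and aM: "a \<in> M" using x a A(2) by auto
  have "b \<otimes> (a \<otimes> x \<otimes> inv a) \<otimes> inv b \<in> K" if b: "b \<in> A" for b
  proof -
    have "(b \<otimes> a) \<otimes> x \<otimes> inv (b \<otimes> a) \<in> K" using x A.m_closed[OF b a] by blast
    moreover have "(b \<otimes> a) \<otimes> x \<otimes> inv (b \<otimes> a) = b \<otimes> (a \<otimes> x \<otimes> inv a) \<otimes> inv b"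
      using a b xM by (simp add: group_word_simps)
    ultimately show ?thesis by simp
  qed
  moreover have "a \<otimes> x \<otimes> inv a \<in> M" using xM aM by simp
  ultimately show ?thesis by blast
qed

text \<open>Induction on \<open>T\<close>, which is an arbitrary finite set rather than a subgroup:
  each new element intersects the core with one more conjugate of \<open>K\<close>.\<close>

lemma finitely_covers_conj_core_finite:
  assumes M: "subgroup M G" and K: "subgroup K G" and cov: "finitely_covers G K M"
    and T: "finite T" "T \<subseteq> M"
  shows "finitely_covers G {x \<in> M. \<forall>a\<in>T. a \<otimes> x \<otimes> inv a \<in> K} M"
  using T
proof (induction T rule: finite_induct)
  case empty
  have "M \<subseteq> M <#> {\<one>}" using subgroup.subset[OF M] by (force simp: set_mult_def)
  then show ?case unfolding finitely_covers_def by (intro exI[of _ "{\<one>}"]) auto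
next
  case (insert t T)
  interpret M: subgroup M G by fact
  define C where "C = {x \<in> M. \<forall>a\<in>T. a \<otimes> x \<otimes> inv a \<in> K}"
  have C: "subgroup C G"
    unfolding C_def using insert.prems by (intro subgroup_conj_core M K) auto
  have t: "t \<in> M" "t \<in> carrier G" using insert.prems by auto
  have CM: "C \<subseteq> M" by (auto simp: C_def)
  have CM': "x \<in> M" "x \<in> carrier G" if "x \<in> C" for x using CM that by auto
  have img: "(\<lambda>x. t \<otimes> x \<otimes> inv t) ` C \<subseteq> M"
    using t(1) CM' by auto
  \<comment> \<open>The new core is the preimage of \<open>K\<close> under conjugation by
    \<open>t\<close> on \<open>C\<close>. The image of this map stays inside \<open>M\<close>, where
    \<open>K\<close> has finitely many cosets.\<close>
  have "finitely_covers G {x \<in> C. t \<otimes> x \<otimes> inv t \<in> K} C"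
  proof (rule finitely_covers_vimage[OF C K])
    show "(\<lambda>x. t \<otimes> x \<otimes> inv t) \<in> C \<rightarrow> carrier G" using t CM' by auto
    show "t \<otimes> (x \<otimes> y) \<otimes> inv t = (t \<otimes> x \<otimes> inv t) \<otimes> (t \<otimes> y \<otimes> inv t)" if "x \<in> C" "y \<in> C" for x y
      using t CM' that by (simp add: group_word_simps)
    show "finitely_covers G K ((\<lambda>x. t \<otimes> x \<otimes> inv t) ` C)"
      using finitely_covers_mono[OF cov order.refl img] .
  qed
  moreover have "finitely_covers G C M" using insert by (auto simp: C_def)
  ultimately have "finitely_covers G {x \<in> C. t \<otimes> x \<otimes> inv t \<in> K} M"
    by (rule finitely_covers_trans) (use CM in auto)
  moreover have "{x \<in> C. t \<otimes> x \<otimes> inv t \<in> K} = {x \<in> M. \<forall>a\<in>insert t T. a \<otimes> x \<otimes> inv a \<in> K}"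
    by (auto simp: C_def)
  ultimately show ?case by simp
qed

text \<open>For \<open>a = k \<otimes> t\<close> with \<open>k\<close> in \<open>K\<close>, the
  conjugate of \<open>x\<close> by \<open>a\<close> lies in \<open>K\<close> as soon as the one by
  \<open>t\<close> does. So the core for a possibly infinite \<open>A\<close> contains the core for
  finitely many representatives.\<close>

lemma finitely_covers_conj_core:
  assumes M: "subgroup M G" and K: "subgroup K G" and cov: "finitely_covers G K M" and A: "A \<subseteq> M"
  shows "finitely_covers G {x \<in> M. \<forall>a\<in>A. a \<otimes> x \<otimes> inv a \<in> K} M"
proof -
  interpret M: subgroup M G by fact
  interpret K: subgroup K G by fact
  have "finitely_covers G K A" using cov A by (rule finitely_covers_mono[OF _ order.refl])
  then obtain T where T: "finite T" "T \<subseteq> A" "A \<subseteq> K <#> T"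
    using finitely_covers_representatives[of K A] A K M.subset by blast
  have "a \<otimes> x \<otimes> inv a \<in> K"
    if x: "x \<in> M" "\<forall>t\<in>T. t \<otimes> x \<otimes> inv t \<in> K" and a: "a \<in> A" for a x
  proof -
    obtain k t where kt: "k \<in> K" "t \<in> T" "a = k \<otimes> t" using T(3) a by (auto simp: set_mult_def)
    have "t \<in> carrier G" using kt T(2) A by auto
    moreover have "k \<otimes> (t \<otimes> x \<otimes> inv t) \<otimes> inv k \<in> K" using x kt by auto
    ultimately show ?thesis using x(1) kt(1,3) by (simp add: group_word_simps)
  qed
  then have "{x \<in> M. \<forall>a\<in>T. a \<otimes> x \<otimes> inv a \<in> K} \<subseteq> {x \<in> M. \<forall>a\<in>A. a \<otimes> x \<otimes> inv a \<in> K}" by auto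
  moreover have "finitely_covers G {x \<in> M. \<forall>a\<in>T. a \<otimes> x \<otimes> inv a \<in> K} M"
    using T A by (intro finitely_covers_conj_core_finite M K cov) auto
  ultimately show ?thesis using finitely_covers_mono by blast
qed

text \<open>Schreier's lemma: the elements \<open>t s t'\<^sup>-\<^sup>1\<close> of \<open>Z\<close>, with \<open>t, t'\<close> coset representatives, generate \<open>Z\<close>.\<close>

lemma finitely_generated_if_finitely_covers:
  assumes S: "finite S" "S \<subseteq> carrier G" and Z: "subgroup Z G" "Z \<subseteq> generate G S"
    and cov: "finitely_covers G Z (generate G S)"
  obtains U where "finite U" "U \<subseteq> Z" "generate G U = Z"
proof -
  interpret Z: subgroup Z G by fact
  interpret H: subgroup "generate G S" G using S(2) by (rule generate_is_subgroup)
  obtain T0 where T0: "finite T0" "T0 \<subseteq> generate G S" "generate G S \<subseteq> Z <#> T0"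
    using finitely_covers_representatives[OF cov Z(1) H.subset] .
  define T where "T = insert \<one> T0"
  have T: "finite T" "T \<subseteq> carrier G" "T \<subseteq> generate G S" "\<one> \<in> T"
    using T0 H.subset by (auto simp: T_def)
  have ZT: "generate G S \<subseteq> Z <#> T"
    using T0(3) mono_set_mult[of Z Z T0 T] by (auto simp: T_def)
  \<comment> \<open>The rule \<open>generate.inv\<close> introduces inverses of generators, so these
    must also be allowed as right factors.\<close>
  define S' where "S' = S \<union> m_inv G ` S"
  have S': "finite S'" "S' \<subseteq> generate G S"
    using S by (auto simp: S'_def intro: generate.incl generate.inv)
  \<comment> \<open>The extra \<open>\<one>\<close> beside \<open>S'\<close> puts every
    representative \<open>t\<close> that lies in \<open>Z\<close> into \<open>U\<close>, as
    \<open>t \<otimes> \<one> \<otimes> inv \<one>\<close>. The end of the proof relies on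
    this.\<close>
  define U where "U = Z \<inter> (\<lambda>(t, s, t'). t \<otimes> s \<otimes> inv t') ` (T \<times> insert \<one> S' \<times> T)"
  have finU: "finite U" using T(1) S'(1) by (simp add: U_def)
  have UZ: "U \<subseteq> Z" by (auto simp: U_def)
  have UU: "generate G U \<subseteq> Z" using generate_subgroup_incl[OF UZ Z(1)] .
  interpret U: subgroup "generate G U" G using UZ Z.subset by (intro generate_is_subgroup) auto
  \<comment> \<open>The set \<open>generate G U <#> T\<close> is stable under right multiplication
    by generators. As it contains \<open>\<one>\<close>, it contains all of
    \<open>generate G S\<close>.\<close>
  have step: "x \<otimes> s \<in> generate G U <#> T" if x: "x \<in> generate G U <#> T" and s: "s \<in> S'" for x s
  proof -
    obtain u t where ut: "u \<in> generate G U" "t \<in> T" "x = u \<otimes> t" using x by (auto simp: set_mult_def)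
    have "t \<otimes> s \<in> Z <#> T" using ut(2) s T(3) ZT S'(2) by blast
    then obtain z t' where zt: "z \<in> Z" "t' \<in> T" "t \<otimes> s = z \<otimes> t'" by (auto simp: set_mult_def)
    have c: "u \<in> carrier G" "t \<in> carrier G" "t' \<in> carrier G" "s \<in> carrier G" "z \<in> carrier G"
      using ut zt T(2) s S'(2) H.subset by auto
    have "z = t \<otimes> s \<otimes> inv t'" using c by (simp add: zt(3) group_word_simps)
    then have "z \<in> U" using zt ut s by (force simp: U_def)
    then have "u \<otimes> z \<in> generate G U" using ut(1) by (simp add: generate.incl)
    moreover have "x \<otimes> s = (u \<otimes> z) \<otimes> t'" using c zt(3) ut(3) by (simp add: m_assoc)
    ultimately show ?thesis using zt(2) unfolding set_mult_def by blast
  qed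
  have UT: "generate G U <#> T \<subseteq> carrier G" using U.subset T(2) by (rule set_mult_closed)
  have all: "x \<otimes> h \<in> generate G U <#> T" if "h \<in> generate G S" "x \<in> generate G U <#> T" for x h
    using that
  proof (induction arbitrary: x rule: generate.induct)
    case one
    then show ?case using UT by auto
  next
    case (incl h)
    then show ?case by (intro step) (auto simp: S'_def)
  next
    case (inv h)
    then show ?case by (intro step) (auto simp: S'_def)
  next
    case (eng h1 h2)
    have "x \<otimes> h1 \<otimes> h2 \<in> generate G U <#> T" using eng by blast
    moreover have "x \<in> carrier G" "h1 \<in> carrier G" "h2 \<in> carrier G"
      using eng UT H.subset by auto
    ultimately show ?case by (simp add: m_assoc)
  qed
  have "Z \<subseteq> generate G U"
  proof
    fix z assume z: "z \<in> Z"
    have "\<one> \<otimes> \<one> \<in> generate G U <#> T" using T(4) U.one_closed unfolding set_mult_def by blast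
    then have "\<one> \<otimes> z \<in> generate G U <#> T" using all[of z "\<one> \<otimes> \<one>"] z Z(2) by auto
    then have "z \<in> generate G U <#> T" using z by simp
    then obtain u t where ut: "u \<in> generate G U" "t \<in> T" "z = u \<otimes> t"
      unfolding set_mult_def by blast
    have c: "u \<in> carrier G" "t \<in> carrier G" using ut T(2) by auto
    \<comment> \<open>The product \<open>z\<close> and its factor \<open>u\<close> are in
      \<open>Z\<close>, hence so is the representative \<open>t\<close>; then \<open>t\<close> is
      itself one of the generators in \<open>U\<close>.\<close>
    have "u \<in> Z" using ut UU by auto
    moreover have "t = inv u \<otimes> z" using c by (simp add: ut(3) group_word_simps)
    ultimately have "t \<in> Z" using z by auto
    moreover have "t = t \<otimes> \<one> \<otimes> inv \<one>" using c by simp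
    ultimately have "t \<in> U" using ut(2) T(4) by (force simp: U_def)
    then show "z \<in> generate G U" using ut by (simp add: generate.incl)
  qed
  then show thesis using that finU UZ UU by blast
qed

end

section \<open>Powers and torsion in finitely generated abelian groups\<close>

context comm_group
begin

text \<open>Commutativity lets all powers of \<open>s\<close> be collected into a single
  factor.\<close>

lemma generate_insertE:
  assumes "S \<subseteq> carrier G" "s \<in> carrier G" "x \<in> generate G (insert s S)"
  obtains y i where "y \<in> generate G S" "x = y \<otimes> s [^] (i::int)"
proof -
  interpret Y: subgroup "generate G S" G using assms(1) by (rule generate_is_subgroup)
  have "\<exists>y\<in>generate G S. \<exists>i::int. x = y \<otimes> s [^] i"
    using assms(3)
  proof (induction rule: generate.induct)
    case one
    have "\<one> = \<one> \<otimes> s [^] (0::int)" by simp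
    then show ?case using Y.one_closed by blast
  next
    case (incl h)
    show ?case
    proof (cases "h = s")
      case True
      then have "h = \<one> \<otimes> s [^] (1::int)" using assms(2) by (simp add: int_pow_1)
      then show ?thesis using Y.one_closed by blast
    next
      case False
      then have h: "h \<in> generate G S" using incl by (auto intro: generate.incl)
      then have "h = h \<otimes> s [^] (0::int)" by simp
      then show ?thesis using h by blast
    qed
  next
    case (inv h)
    show ?case
    proof (cases "h = s")
      case True
      then have "inv h = \<one> \<otimes> s [^] (-1::int)" using assms(2) by (simp add: int_pow_neg int_pow_1)
      then show ?thesis using Y.one_closed by blast
    next
      case False
      then have h: "inv h \<in> generate G S" using inv by (auto intro: generate.inv)
      then have "inv h = inv h \<otimes> s [^] (0::int)" by simp
      then show ?thesis using h by blast
    qed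
  next
    case (eng h1 h2)
    then obtain y1 y2 and i1 i2 :: int where *: "y1 \<in> generate G S" "h1 = y1 \<otimes> s [^] i1"
      "y2 \<in> generate G S" "h2 = y2 \<otimes> s [^] i2" by blast
    have "h1 \<otimes> h2 = (y1 \<otimes> y2) \<otimes> s [^] (i1 + i2)"
      using * assms(2) by (simp add: int_pow_mult m_ac)
    then show ?case using * by blast
  qed
  then show thesis using that by blast
qed

lemma subgroup_powers: "subgroup ((\<lambda>w. w [^] (m::nat)) ` carrier G) G"
proof (rule subgroupI)
  have "\<one> [^] m \<in> (\<lambda>w. w [^] m) ` carrier G" by blast
  then show "(\<lambda>w. w [^] m) ` carrier G \<noteq> {}" by blast
next
  fix a assume "a \<in> (\<lambda>w. w [^] m) ` carrier G"
  then obtain w where "w \<in> carrier G" "a = w [^] m" by blast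
  then have "inv w \<in> carrier G" "inv a = inv w [^] m" by (auto simp: nat_pow_inv)
  then show "inv a \<in> (\<lambda>w. w [^] m) ` carrier G" by blast
next
  fix a b assume "a \<in> (\<lambda>w. w [^] m) ` carrier G" "b \<in> (\<lambda>w. w [^] m) ` carrier G"
  then obtain v w where "v \<in> carrier G" "a = v [^] m" "w \<in> carrier G" "b = w [^] m" by blast
  then have "v \<otimes> w \<in> carrier G" "a \<otimes> b = (v \<otimes> w) [^] m" by (auto simp: nat_pow_distrib)
  then show "a \<otimes> b \<in> (\<lambda>w. w [^] m) ` carrier G" by blast
qed auto

text \<open>Dividing the exponent of \<open>s\<close> by \<open>m\<close> leaves a remainder from a
  finite range, while the quotient part is absorbed into the \<open>m\<close>-th power. Powers of
  all of \<open>carrier G\<close> are used so that the covering set stays fixed while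
  \<open>S\<close> grows.\<close>

lemma finitely_covers_powers:
  assumes "finite S" "S \<subseteq> carrier G" "(m::nat) > 0"
  shows "finitely_covers G ((\<lambda>w. w [^] m) ` carrier G) (generate G S)"
  using assms(1,2)
proof (induction S rule: finite_induct)
  case empty
  have "\<one> = \<one> [^] m \<otimes> \<one>" by simp
  then have "{\<one>} \<subseteq> (\<lambda>w. w [^] m) ` carrier G <#> {\<one>}" unfolding set_mult_def by blast
  then show ?case unfolding finitely_covers_def generate_empty by blast
next
  case (insert s S)
  have s: "s \<in> carrier G" and S: "S \<subseteq> carrier G" using insert.prems by auto
  let ?W = "(\<lambda>w. w [^] m) ` carrier G" and ?P = "(\<lambda>i. s [^] i) ` {0..<int m}"
  have W: "?W \<subseteq> carrier G" by auto
  obtain T where T: "finite T" "T \<subseteq> carrier G" "generate G S \<subseteq> ?W <#> T"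
    using insert.IH[OF S] unfolding finitely_covers_def by blast
  have "generate G (insert s S) \<subseteq> ?W <#> (T <#> ?P)"
  proof
    fix x assume "x \<in> generate G (insert s S)"
    with S s obtain y i where yi: "y \<in> generate G S" "x = y \<otimes> s [^] (i::int)"
      by (rule generate_insertE)
    then obtain w t where wt: "w \<in> carrier G" "t \<in> T" "y = w [^] m \<otimes> t"
      using T(3) unfolding set_mult_def by blast
    have t: "t \<in> carrier G" using wt T by auto
    have "s [^] i = s [^] ((i div int m) * int m + i mod int m)" by simp
    also have "\<dots> = (s [^] (i div int m)) [^] m \<otimes> s [^] (i mod int m)"
      using s by (simp only: int_pow_mult int_pow_pow int_pow_int flip: int_pow_int)
    finally have "x = (w \<otimes> s [^] (i div int m)) [^] m \<otimes> (t \<otimes> s [^] (i mod int m))"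
      using yi(2) wt(1,3) s t by (simp add: nat_pow_distrib m_ac)
    moreover have "w \<otimes> s [^] (i div int m) \<in> carrier G" using wt s by simp
    moreover have "i mod int m \<in> {0..<int m}" using assms(3) by simp
    ultimately show "x \<in> ?W <#> (T <#> ?P)" using wt(2) unfolding set_mult_def by blast
  qed
  moreover have "finite (T <#> ?P)" using T(1) by (simp add: set_mult_def)
  moreover have "T <#> ?P \<subseteq> carrier G" using T(2) s by (intro set_mult_closed) auto
  ultimately show ?case unfolding finitely_covers_def by blast
qed

lemma subgroup_generate_torsion:
  assumes "S \<subseteq> carrier G"
  shows "subgroup {x \<in> generate G S. x [^] (m::nat) = \<one>} G"
proof (rule subgroupI)
  interpret Y: subgroup "generate G S" G using assms by (rule generate_is_subgroup)
  show "{x \<in> generate G S. x [^] m = \<one>} \<subseteq> carrier G" by auto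
  have "\<one> \<in> {x \<in> generate G S. x [^] m = \<one>}" by simp
  then show "{x \<in> generate G S. x [^] m = \<one>} \<noteq> {}" by blast
  fix a assume a: "a \<in> {x \<in> generate G S. x [^] m = \<one>}"
  then show "inv a \<in> {x \<in> generate G S. x [^] m = \<one>}"
    using Y.mem_carrier by (simp add: nat_pow_inv)
  fix b assume "b \<in> {x \<in> generate G S. x [^] m = \<one>}"
  with a show "a \<otimes> b \<in> {x \<in> generate G S. x [^] m = \<one>}"
    by (simp add: nat_pow_distrib)
qed

text \<open>Adjoining a generator \<open>s\<close> enlarges the torsion only finitely: either some positive power of \<open>s\<close>
  lies in the old subgroup, which then has finite index, or no torsion element is added at all.\<close>

lemma finite_torsion_generate:
  assumes "finite S" "S \<subseteq> carrier G" "(m::nat) > 0"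
  shows "finite {x \<in> generate G S. x [^] m = \<one>}"
  using assms(1,2)
proof (induction S rule: finite_induct)
  case empty
  then show ?case by (simp add: generate_empty)
next
  case (insert s S)
  have s: "s \<in> carrier G" and S: "S \<subseteq> carrier G" and sS: "insert s S \<subseteq> carrier G"
    using insert.prems by auto
  interpret Y: subgroup "generate G S" G using S by (rule generate_is_subgroup)
  let ?M = "{x \<in> generate G (insert s S). x [^] m = \<one>}"
  have M: "subgroup ?M G" using sS by (rule subgroup_generate_torsion)
  interpret M: subgroup ?M G by (fact M)
  \<comment> \<open>A finite cover of the new torsion by the old subgroup suffices: intersecting
    with the torsion gives a cover by old torsion, which is finite by induction.\<close>
  have "finitely_covers G (generate G S) ?M"
  proof (cases "\<exists>k::int. k > 0 \<and> s [^] k \<in> generate G S")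
    case True
    then obtain k :: int where k: "k > 0" "s [^] k \<in> generate G S" by blast
    have "?M \<subseteq> generate G S <#> (\<lambda>i. s [^] i) ` {0..<k}"
    proof
      fix x assume "x \<in> ?M"
      then obtain y i where yi: "y \<in> generate G S" "x = y \<otimes> s [^] (i::int)"
        using generate_insertE[OF S s] by blast
      have "s [^] i = s [^] (k * (i div k) + i mod k)" by simp
      also have "\<dots> = (s [^] k) [^] (i div k) \<otimes> s [^] (i mod k)"
        using s by (simp only: int_pow_mult int_pow_pow)
      finally have "x = (y \<otimes> (s [^] k) [^] (i div k)) \<otimes> s [^] (i mod k)"
        using yi s by (simp add: m_assoc)
      moreover have "y \<otimes> (s [^] k) [^] (i div k) \<in> generate G S"
        using yi(1) k(2) Y.subgroup_axioms by (simp add: subgroup_int_pow_closed)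
      moreover have "i mod k \<in> {0..<k}" using k(1) by simp
      ultimately show "x \<in> generate G S <#> (\<lambda>i. s [^] i) ` {0..<k}"
        unfolding set_mult_def by blast
    qed
    moreover have "(\<lambda>i. s [^] i) ` {0..<k} \<subseteq> carrier G" using s by auto
    ultimately show ?thesis unfolding finitely_covers_def by blast
  next
    case False
    have "?M \<subseteq> generate G S"
    proof
      fix x assume x: "x \<in> ?M"
      then obtain y i where yi: "y \<in> generate G S" "x = y \<otimes> s [^] (i::int)"
        using generate_insertE[OF S s] by blast
      have y: "y \<in> carrier G" using yi by simp
      have "y [^] m \<otimes> s [^] (i * int m) = x [^] m"
        using yi(2) y s by (simp add: int_pow_distrib int_pow_pow flip: int_pow_int)
      also have "\<dots> = \<one>" using x by simp
      finally have 1: "s [^] (i * int m) = inv (y [^] m)"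
        using y s by (metis inv_equality inv_inv int_pow_closed nat_pow_closed)
      have ym: "y [^] m \<in> generate G S"
        using subgroup_int_pow_closed[OF Y.subgroup_axioms yi(1), of "int m"] by (simp add: int_pow_int)
      have p: "s [^] (i * int m) \<in> generate G S" "s [^] (- (i * int m)) \<in> generate G S"
        using 1 ym s y by (simp_all add: int_pow_neg)
      \<comment> \<open>If \<open>i\<close> were nonzero, one of these two exponents would be a
        positive power of \<open>s\<close> in the old subgroup.\<close>
      have "\<not> i * int m > 0" "\<not> - (i * int m) > 0" using p False by blast+
      then have "i * int m = 0" by linarith
      then have "i = 0" using assms(3) by simp
      then show "x \<in> generate G S" using yi by simp
    qed
    then have "?M \<subseteq> generate G S <#> {\<one>}" using Y.subset by (force simp: set_mult_def)
    then show ?thesis unfolding finitely_covers_def by (intro exI[of _ "{\<one>}"]) auto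
  qed
  then have "finitely_covers G (generate G S \<inter> ?M) ?M"
    by (rule finitely_covers_Int[OF M Y.subgroup_axioms])
  then obtain T where T: "finite T" "?M \<subseteq> (generate G S \<inter> ?M) <#> T"
    unfolding finitely_covers_def by blast
  have "finite (generate G S \<inter> ?M)"
    by (rule finite_subset[OF _ insert.IH[OF S]]) auto
  then have "finite ((generate G S \<inter> ?M) <#> T)" using T(1) by (simp add: set_mult_def)
  then show ?case using T(2) by (rule rev_finite_subset)
qed

end

section \<open>Retractions\<close>

text \<open>Membership in \<open>hom\<close> only gives compatibility with products. Preservation of
  \<open>\<one>\<close> handles empty products and infinite \<open>C\<close>, where
  \<open>finprod\<close> takes the default value \<open>\<one>\<close>.\<close>

lemma (in comm_monoid) hom_finprod:
  assumes "h \<in> hom G G" "h \<one> = \<one>" "f \<in> C \<rightarrow> carrier G"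
  shows "h (finprod G f C) = finprod G (\<lambda>c. h (f c)) C"
  using assms(3)
proof (induction C rule: infinite_finite_induct)
  case (insert c C)
  then have "f c \<in> carrier G" "f \<in> C \<rightarrow> carrier G" by auto
  moreover have "(\<lambda>c. h (f c)) \<in> C \<rightarrow> carrier G" "h (f c) \<in> carrier G"
    using insert.prems assms(1) by (auto simp: hom_def)
  ultimately show ?case using insert assms(1) by (simp add: hom_mult)
qed (simp_all add: assms(2))

context group
begin

text \<open>One normal subgroup of finite index is intersected for each nontrivial element of
  \<open>F\<close>.\<close>

lemma residually_finite_avoids_finite:
  assumes "residually_finite G" "finite F" "F \<subseteq> carrier G"
  obtains M where "M \<lhd> G" "finitely_covers G M (carrier G)" "M \<inter> F \<subseteq> {\<one>}"
proof -
  have "\<exists>M. M \<lhd> G \<and> finitely_covers G M (carrier G) \<and> M \<inter> F \<subseteq> {\<one>}"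
    using assms(2,3)
  proof (induction F rule: finite_induct)
    case empty
    have "carrier G \<subseteq> carrier G <#> {\<one>}" by (force simp: set_mult_def)
    then have "finitely_covers G (carrier G) (carrier G)"
      unfolding finitely_covers_def by (intro exI[of _ "{\<one>}"]) auto
    then show ?case using normal_self by blast
  next
    case (insert g F)
    then obtain M where M: "M \<lhd> G" "finitely_covers G M (carrier G)" "M \<inter> F \<subseteq> {\<one>}" by auto
    show ?case
    proof (cases "g = \<one>")
      case True
      then have "M \<inter> insert g F \<subseteq> {\<one>}" using M(3) by auto
      then show ?thesis using M by blast
    next
      case False
      then obtain N where N: "N \<lhd> G" "finite_index_subgroup N G" "g \<notin> N"
        using assms(1) insert.prems unfolding residually_finite_def by auto
      have sub: "subgroup M G" "subgroup N G" using M(1) N(1) by (auto intro: normal_imp_subgroup)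
      have covN: "finitely_covers G N (carrier G)"
        using N(2) sub(2) by (simp add: finite_index_subgroup_def finite_rcosets_iff_finitely_covers)
      have "N \<inter> M \<lhd> G" using N(1) M(1) sub subgroups_Inter_pair[of N M] by (auto simp: normal_inv_iff)
      moreover have "finitely_covers G (N \<inter> M) (carrier G)"
      proof (rule finitely_covers_trans[OF _ M(2)])
        show "finitely_covers G (N \<inter> M) M"
          using sub covN finitely_covers_mono[OF covN order.refl subgroup.subset[OF sub(1)]]
          by (intro finitely_covers_Int)
      qed (use subgroup.subset[OF sub(1)] in auto)
      moreover have "(N \<inter> M) \<inter> insert g F \<subseteq> {\<one>}" using M(3) N(3) by auto
      ultimately show ?thesis by blast
    qed
  qed
  then show thesis using that by blast
qed

text \<open>The product \<open>A <#> N\<close> is an internal semidirect product, and its projection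
  to \<open>A\<close> with kernel \<open>N\<close> is the retraction.\<close>

lemma virtual_retract_complement:
  assumes A: "subgroup A G" and N: "subgroup N G"
    and norm: "\<And>a n. a \<in> A \<Longrightarrow> n \<in> N \<Longrightarrow> a \<otimes> n \<otimes> inv a \<in> N"
    and triv: "A \<inter> N \<subseteq> {\<one>}" and cov: "finitely_covers G (A <#> N) (carrier G)"
  shows "virtual_retract A G"
proof -
  interpret A: subgroup A G by fact
  interpret N: subgroup N G by fact
  define K where "K = A <#> N"
  have K_iff: "x \<in> K \<longleftrightarrow> (\<exists>a\<in>A. \<exists>n\<in>N. x = a \<otimes> n)" for x by (auto simp: K_def set_mult_def)
  have norm': "inv a \<otimes> n \<otimes> a \<in> N" if "a \<in> A" "n \<in> N" for a n
    using norm[of "inv a" n] that by simp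
  \<comment> \<open>Moving \<open>b\<close> to the left past \<open>n\<close> conjugates
    \<open>n\<close> within \<open>N\<close>. This gives closure of \<open>K\<close> and
    multiplicativity of the projection.\<close>
  have mult: "(a \<otimes> n) \<otimes> (b \<otimes> k) = (a \<otimes> b) \<otimes> ((inv b \<otimes> n \<otimes> b) \<otimes> k)"
    if "a \<in> A" "b \<in> A" "n \<in> N" "k \<in> N" for a b n k
    using that by (simp add: group_word_simps)
  \<comment> \<open>Equal products give \<open>inv b \<otimes> a = k \<otimes> inv n\<close>, an
    element of the trivial intersection. This makes the description by \<open>THE\<close> below well
    defined.\<close>
  have uniq: "a = b" if "a \<in> A" "b \<in> A" "n \<in> N" "k \<in> N" "a \<otimes> n = b \<otimes> k" for a b n k
  proof -
    have "inv b \<otimes> (a \<otimes> n) \<otimes> inv n = inv b \<otimes> (b \<otimes> k) \<otimes> inv n" using that(5) by simp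
    then have "inv b \<otimes> a = k \<otimes> inv n" using that(1-4) by (simp add: group_word_simps)
    moreover have "inv b \<otimes> a \<in> A" "k \<otimes> inv n \<in> N" using that(1-4) by simp_all
    ultimately have "inv b \<otimes> a \<in> A \<inter> N" by simp
    then have "b \<otimes> (inv b \<otimes> a) = b" using triv that by auto
    then show ?thesis using that by (simp add: group_word_simps)
  qed
  have subK: "subgroup K G"
  proof (rule subgroupI)
    show "K \<subseteq> carrier G" by (auto simp: K_iff)
    have "\<one> \<otimes> \<one> \<in> K" unfolding K_iff using A.one_closed N.one_closed by blast
    then show "K \<noteq> {}" by blast
    fix x assume "x \<in> K"
    then obtain a n where an: "a \<in> A" "n \<in> N" "x = a \<otimes> n" by (auto simp: K_iff)
    then have "inv x = inv a \<otimes> (a \<otimes> inv n \<otimes> inv a)" by (simp add: group_word_simps)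
    then show "inv x \<in> K" using an norm[of a "inv n"] unfolding K_iff by blast
    fix y assume "y \<in> K"
    then obtain b k where bk: "b \<in> A" "k \<in> N" "y = b \<otimes> k" by (auto simp: K_iff)
    then have "x \<otimes> y = (a \<otimes> b) \<otimes> ((inv b \<otimes> n \<otimes> b) \<otimes> k)" using mult an bk by simp
    then show "x \<otimes> y \<in> K"
      unfolding K_iff using an bk norm'[of b n] by blast
  qed
  have AK: "A \<subseteq> K" unfolding K_iff subset_iff using N.one_closed A.mem_carrier r_one by metis
  define \<rho> where "\<rho> x = (THE a. a \<in> A \<and> (\<exists>n\<in>N. x = a \<otimes> n))" for x
  have \<rho>: "\<rho> (a \<otimes> n) = a" if "a \<in> A" "n \<in> N" for a n
    unfolding \<rho>_def by (rule the_equality) (use that uniq in blast)+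
  have "\<rho> a = a" if "a \<in> A" for a using \<rho>[of a \<one>] that by simp
  moreover have "\<rho> \<in> hom (G\<lparr>carrier := K\<rparr>) (G\<lparr>carrier := K, carrier := A\<rparr>)"
  proof (rule homI)
    fix x assume "x \<in> carrier (G\<lparr>carrier := K\<rparr>)"
    then obtain a n where an: "a \<in> A" "n \<in> N" "x = a \<otimes> n" by (auto simp: K_iff)
    then show "\<rho> x \<in> carrier (G\<lparr>carrier := K, carrier := A\<rparr>)" using \<rho> by simp
    fix y assume "y \<in> carrier (G\<lparr>carrier := K\<rparr>)"
    then obtain b k where bk: "b \<in> A" "k \<in> N" "y = b \<otimes> k" by (auto simp: K_iff)
    have "\<rho> (x \<otimes> y) = a \<otimes> b"
      using mult[of a b n k] \<rho>[of "a \<otimes> b" "(inv b \<otimes> n \<otimes> b) \<otimes> k"] an bk norm'[of b n] by simp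
    then show "\<rho> (x \<otimes>\<^bsub>G\<lparr>carrier := K\<rparr>\<^esub> y) = \<rho> x \<otimes>\<^bsub>G\<lparr>carrier := K, carrier := A\<rparr>\<^esub> \<rho> y"
      using an bk \<rho> by simp
  qed
  moreover have "subgroup A (G\<lparr>carrier := K\<rparr>)" using A subK AK by (rule subgroup_incl)
  ultimately have "group_retract A (G\<lparr>carrier := K\<rparr>)" unfolding group_retract_def by auto
  moreover have "finite_index_subgroup K G"
    using subK cov by (simp add: finite_index_subgroup_def finite_rcosets_iff_finitely_covers K_def)
  ultimately show ?thesis using A AK unfolding virtual_retract_def by blast
qed

text \<open>The conjugates \<open>k \<mapsto> inv a \<otimes> \<rho> (a \<otimes> k \<otimes> inv a) \<otimes> a\<close> of the retraction \<open>\<rho>\<close> depend only on the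
  coset \<open>Z #> a\<close>, and their product over all cosets is equivariant.\<close>

lemma averaged_retraction:
  assumes A: "subgroup A G" and Z: "subgroup Z G" and ZA: "Z \<subseteq> A" and cov: "finitely_covers G Z A"
    and normZ: "\<And>a z. a \<in> A \<Longrightarrow> z \<in> Z \<Longrightarrow> a \<otimes> z \<otimes> inv a \<in> Z"
    and comm: "comm_group (G\<lparr>carrier := Z\<rparr>)"
    and K: "subgroup K G" and ZK: "Z \<subseteq> K"
    and normK: "\<And>a k. a \<in> A \<Longrightarrow> k \<in> K \<Longrightarrow> a \<otimes> k \<otimes> inv a \<in> K"
    and \<rho>: "\<And>k. k \<in> K \<Longrightarrow> \<rho> k \<in> Z"
      "\<And>k l. k \<in> K \<Longrightarrow> l \<in> K \<Longrightarrow> \<rho> (k \<otimes> l) = \<rho> k \<otimes> \<rho> l" "\<And>z. z \<in> Z \<Longrightarrow> \<rho> z = z"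
  obtains \<phi> and m :: nat where "m > 0" "\<And>k. k \<in> K \<Longrightarrow> \<phi> k \<in> Z"
    "\<And>k l. k \<in> K \<Longrightarrow> l \<in> K \<Longrightarrow> \<phi> (k \<otimes> l) = \<phi> k \<otimes> \<phi> l" "\<And>z. z \<in> Z \<Longrightarrow> \<phi> z = z [^] m"
    "\<And>a k. a \<in> A \<Longrightarrow> k \<in> K \<Longrightarrow> \<phi> (a \<otimes> k \<otimes> inv a) = a \<otimes> \<phi> k \<otimes> inv a"
proof -
  interpret A: subgroup A G by fact
  interpret Z: subgroup Z G by fact
  interpret K: subgroup K G by fact
  \<comment> \<open>A \<open>finprod\<close> needs a commutative structure, so the product over
    cosets is formed in \<open>Z\<close> rather than in \<open>G\<close>.\<close>
  define D where "D = G\<lparr>carrier := Z\<rparr>"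
  interpret D: comm_group D using comm by (simp add: D_def)
  have D_simps: "carrier D = Z" "x \<otimes>\<^bsub>D\<^esub> y = x \<otimes> y" "\<one>\<^bsub>D\<^esub> = \<one>" "x [^]\<^bsub>D\<^esub> (n::nat) = x [^] n" for x y n
    by (simp_all add: D_def nat_pow_consistent[symmetric])
  define C where "C = (\<lambda>a. Z #> a) ` A"
  have "finite_index_subgroup Z (G\<lparr>carrier := A\<rparr>)"
    using A Z ZA cov by (simp add: finite_index_subgroup_iff_finitely_covers)
  then have finC: "finite C"
    by (simp add: finite_index_subgroup_def RCOSETS_def r_coset_def C_def UNION_singleton_eq_range)
  have Cne: "C \<noteq> {}" unfolding C_def using A.one_closed by blast
  define rep where "rep c = (SOME a. a \<in> A \<and> Z #> a = c)" for c
  have rep: "rep (Z #> a) \<in> A \<and> Z #> rep (Z #> a) = Z #> a" if "a \<in> A" for a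
    unfolding rep_def by (rule someI_ex) (use that in blast)
  define F where "F k c = inv (rep c) \<otimes> \<rho> (rep c \<otimes> k \<otimes> inv (rep c)) \<otimes> rep c" for k c
  \<comment> \<open>Independence of the representative: replacing \<open>a\<close> by
    \<open>z \<otimes> a\<close> conjugates the argument of \<open>\<rho>\<close> by
    \<open>z\<close>. As \<open>\<rho>\<close> fixes \<open>z\<close>, the value is conjugated by
    \<open>z\<close> too, and the outer factors undo this.\<close>
  have F: "F k (Z #> a) = inv a \<otimes> \<rho> (a \<otimes> k \<otimes> inv a) \<otimes> a" if a: "a \<in> A" and k: "k \<in> K" for a k
  proof -
    define b where "b = rep (Z #> a)"
    have b: "b \<in> A" "Z #> b = Z #> a" using rep[OF a] by (auto simp: b_def)
    then have "b \<in> Z #> a" using rcos_self[of b Z] Z by auto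
    then obtain z where z: "z \<in> Z" "b = z \<otimes> a" by (auto simp: r_coset_def)
    let ?y = "a \<otimes> k \<otimes> inv a"
    have y: "?y \<in> K" using normK a k by simp
    have zK: "z \<in> K" "inv z \<in> K" "z \<otimes> ?y \<in> K" using z(1) ZK y by auto
    have ry: "\<rho> ?y \<in> carrier G" using \<rho>(1)[OF y] by simp
    have "\<rho> (z \<otimes> ?y \<otimes> inv z) = z \<otimes> \<rho> ?y \<otimes> inv z"
      using \<rho>(2)[OF zK(3,2)] \<rho>(2)[OF zK(1) y] \<rho>(3) z(1) by simp
    moreover have "b \<otimes> k \<otimes> inv b = z \<otimes> ?y \<otimes> inv z"
      using z a k by (simp add: group_word_simps)
    ultimately have "F k (Z #> a) = inv b \<otimes> (z \<otimes> \<rho> ?y \<otimes> inv z) \<otimes> b"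
      by (simp add: F_def b_def)
    also have "\<dots> = inv a \<otimes> \<rho> ?y \<otimes> a"
      using z a ry by (simp add: group_word_simps)
    finally show ?thesis .
  qed
  have normZ': "inv a \<otimes> z \<otimes> a \<in> Z" if "a \<in> A" "z \<in> Z" for a z
    using normZ[of "inv a" z] that by simp
  have FZ: "F k c \<in> Z" if "c \<in> C" "k \<in> K" for k c
    using that by (auto simp: C_def F intro!: normZ' \<rho>(1) normK)
  have Fmult: "F (k \<otimes> l) c = F k c \<otimes> F l c" if c: "c \<in> C" and kl: "k \<in> K" "l \<in> K" for k l c
  proof -
    obtain a where a: "a \<in> A" "c = Z #> a" using c by (auto simp: C_def)
    have eq: "a \<otimes> (k \<otimes> l) \<otimes> inv a = (a \<otimes> k \<otimes> inv a) \<otimes> (a \<otimes> l \<otimes> inv a)"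
      using a kl by (simp add: group_word_simps)
    have K: "a \<otimes> k \<otimes> inv a \<in> K" "a \<otimes> l \<otimes> inv a \<in> K" using a kl normK by auto
    then have "\<rho> (a \<otimes> k \<otimes> inv a) \<in> carrier G" "\<rho> (a \<otimes> l \<otimes> inv a) \<in> carrier G"
      using \<rho>(1) Z.mem_carrier by blast+
    moreover have "\<rho> (a \<otimes> (k \<otimes> l) \<otimes> inv a) = \<rho> (a \<otimes> k \<otimes> inv a) \<otimes> \<rho> (a \<otimes> l \<otimes> inv a)"
      unfolding eq using \<rho>(2)[OF K] .
    ultimately show ?thesis
      using a kl F[of a] by (simp add: m_assoc mult_inv_cancel_left)
  qed
  define \<phi> where "\<phi> k = finprod D (F k) C" for k
  show thesis
  proof
    \<comment> \<open>The exponent is the index of \<open>Z\<close> in \<open>A\<close>, one factor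
      for each coset.\<close>
    show "card C > 0" using finC Cne by (simp add: card_gt_0_iff)
    show "\<phi> k \<in> Z" if "k \<in> K" for k
      using D.finprod_closed[of "F k" C] FZ that by (auto simp: \<phi>_def D_simps)
    show "\<phi> (k \<otimes> l) = \<phi> k \<otimes> \<phi> l" if kl: "k \<in> K" "l \<in> K" for k l
    proof -
      have "\<phi> (k \<otimes> l) = finprod D (\<lambda>c. F k c \<otimes>\<^bsub>D\<^esub> F l c) C"
        unfolding \<phi>_def using Fmult FZ kl by (intro D.finprod_cong') (auto simp: D_simps)
      also have "\<dots> = \<phi> k \<otimes>\<^bsub>D\<^esub> \<phi> l"
        unfolding \<phi>_def using FZ kl by (intro D.finprod_multf) (auto simp: D_simps)
      finally show ?thesis by (simp add: D_simps)
    qed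
    show "\<phi> z = z [^] card C" if z: "z \<in> Z" for z
    proof -
      \<comment> \<open>On \<open>Z\<close> every conjugate of \<open>\<rho>\<close> is the
        identity, because \<open>A\<close> normalises \<open>Z\<close>.\<close>
      have "F z c = z" if c: "c \<in> C" for c
      proof -
        obtain a where a: "a \<in> A" "c = Z #> a" using c by (auto simp: C_def)
        have "F z c = inv a \<otimes> (a \<otimes> z \<otimes> inv a) \<otimes> a"
          using F[OF a(1), of z] a z ZK \<rho>(3) normZ by auto
        then show ?thesis using a z by (simp add: group_word_simps)
      qed
      then have "\<phi> z = finprod D (\<lambda>c. z) C"
        unfolding \<phi>_def using z by (intro D.finprod_cong') (auto simp: D_simps)
      then show ?thesis using z D.finprod_const[of z C] by (simp add: D_simps)
    qed
    show "\<phi> (a \<otimes> k \<otimes> inv a) = a \<otimes> \<phi> k \<otimes> inv a" if a: "a \<in> A" and k: "k \<in> K" for a k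
    proof -
      have \<sigma>: "(Z #> b) #> a = Z #> (b \<otimes> a)" if "b \<in> A" for b
        using that a Z.subset by (simp add: coset_mult_assoc)
      \<comment> \<open>Right multiplication by \<open>a\<close> permutes the cosets; injectivity
        then follows from surjectivity on a finite set.\<close>
      have \<sigma>C: "(\<lambda>c. c #> a) ` C = C"
      proof
        show "(\<lambda>c. c #> a) ` C \<subseteq> C" using \<sigma> a by (auto simp: C_def)
        show "C \<subseteq> (\<lambda>c. c #> a) ` C"
        proof
          fix c assume "c \<in> C"
          then obtain b where b: "b \<in> A" "c = Z #> b" by (auto simp: C_def)
          have "(Z #> (b \<otimes> inv a)) #> a = c"
            using \<sigma>[of "b \<otimes> inv a"] a b by (simp add: group_word_simps)
          moreover have "Z #> (b \<otimes> inv a) \<in> C" using a b by (auto simp: C_def)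
          ultimately show "c \<in> (\<lambda>c. c #> a) ` C" by blast
        qed
      qed
      then have inj: "inj_on (\<lambda>c. c #> a) C"
        using finC by (simp add: eq_card_imp_inj_on)
      have \<kappa>: "(\<lambda>z. a \<otimes> z \<otimes> inv a) \<in> hom D D"
        using normZ a by (auto simp: hom_def D_simps group_word_simps)
      \<comment> \<open>Conjugating the argument by \<open>a\<close> moves the factor at
        \<open>c\<close> to the one at \<open>c #> a\<close>, conjugated by \<open>a\<close>. The
        shift disappears on reindexing the product.\<close>
      have conj: "F (a \<otimes> k \<otimes> inv a) c = a \<otimes> F k (c #> a) \<otimes> inv a" if c: "c \<in> C" for c
      proof -
        obtain b where b: "b \<in> A" "c = Z #> b" using c by (auto simp: C_def)
        have eq: "b \<otimes> (a \<otimes> k \<otimes> inv a) \<otimes> inv b = (b \<otimes> a) \<otimes> k \<otimes> inv (b \<otimes> a)"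
          using a b k by (simp add: group_word_simps)
        have ba: "b \<otimes> a \<in> A" using a b by simp
        let ?r = "\<rho> ((b \<otimes> a) \<otimes> k \<otimes> inv (b \<otimes> a))"
        have "?r \<in> Z" using \<rho>(1) normK ba k by blast
        then have r: "?r \<in> carrier G" by simp
        have "F (a \<otimes> k \<otimes> inv a) c = inv b \<otimes> ?r \<otimes> b"
          using F[OF b(1) normK[OF a k]] b(2) eq by simp
        also have "\<dots> = a \<otimes> (inv (b \<otimes> a) \<otimes> ?r \<otimes> (b \<otimes> a)) \<otimes> inv a"
        proof -
          have "inv b \<otimes> r \<otimes> b = a \<otimes> (inv (b \<otimes> a) \<otimes> r \<otimes> (b \<otimes> a)) \<otimes> inv a"
            if "r \<in> carrier G" for r
            using that a b(1) by (simp add: group_word_simps)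
          then show ?thesis using r .
        qed
        also have "\<dots> = a \<otimes> F k (c #> a) \<otimes> inv a"
          using F[OF ba k] b \<sigma> by simp
        finally show ?thesis .
      qed
      have Fk: "F k \<in> C \<rightarrow> carrier D" using FZ k by (auto simp: D_simps)
      have Fk\<sigma>: "(\<lambda>c. F k (c #> a)) \<in> C \<rightarrow> carrier D" using FZ[OF _ k] \<sigma>C by (auto simp: D_simps)
      have "\<phi> (a \<otimes> k \<otimes> inv a) = finprod D (\<lambda>c. a \<otimes> F k (c #> a) \<otimes> inv a) C"
        unfolding \<phi>_def
      proof (rule D.finprod_cong')
        show "(\<lambda>c. a \<otimes> F k (c #> a) \<otimes> inv a) \<in> C \<rightarrow> carrier D"
          using Fk\<sigma> normZ a by (auto simp: D_simps)
      qed (use conj in auto)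
      also have "\<dots> = a \<otimes> finprod D (\<lambda>c. F k (c #> a)) C \<otimes> inv a"
        using D.hom_finprod[OF \<kappa> _ Fk\<sigma>] a by (simp add: D_simps)
      also have "finprod D (\<lambda>c. F k (c #> a)) C = finprod D (F k) ((\<lambda>c. c #> a) ` C)"
        using Fk inj \<sigma>C by (intro D.finprod_reindex[symmetric]) auto
      finally show ?thesis by (simp add: \<sigma>C \<phi>_def)
    qed
  qed
qed

end

section \<open>Passing to an overgroup of finite index\<close>

theorem theorem1p4:
  fixes G :: "('a, 'b) monoid_scheme" and H A :: "'a set"
  assumes "group G"
    and "residually_finite G"
    and "subgroup H G"
    and "finitely_generated_group (G\<lparr>carrier := H\<rparr>)"
    and "virtually_abelian (G\<lparr>carrier := H\<rparr>)"
    and "virtual_retract H G"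
    and "subgroup A G"
    and "H \<subseteq> A"
    and "finite_index_subgroup H (G\<lparr>carrier := A\<rparr>)"
  shows "virtual_retract A G"
proof -
  interpret group G by fact
  interpret H: subgroup H G by fact
  interpret A: subgroup A G by fact

  obtain B where B: "finite_index_subgroup B (G\<lparr>carrier := H\<rparr>)" "comm_group (G\<lparr>carrier := B\<rparr>)"
    using assms(5) unfolding virtually_abelian_def by auto
  then have subB: "subgroup B G" and BH: "B \<subseteq> H" and covB: "finitely_covers G B H"
    using assms(3) by (simp_all add: finite_index_subgroup_iff_finitely_covers)
  interpret B: subgroup B G by (fact subB)
  have "finitely_covers G H A"
    using assms(7,9) by (simp add: finite_index_subgroup_iff_finitely_covers)
  with covB have BA: "finitely_covers G B A"
    using B.subset by (rule finitely_covers_trans)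

  \<comment> \<open>The subgroup \<open>B\<close> may fail to be normal in \<open>A\<close>. Its
    core keeps finite index, is normalised by \<open>A\<close>, and is abelian because it lies in
    \<open>B\<close>.\<close>
  define Z where "Z = {x \<in> A. \<forall>a\<in>A. a \<otimes>\<^bsub>G\<^esub> x \<otimes>\<^bsub>G\<^esub> inv\<^bsub>G\<^esub> a \<in> B}"
  have subZ: "subgroup Z G"
    unfolding Z_def by (intro subgroup_conj_core assms(7) subB A.subset)
  interpret Z: subgroup Z G by (fact subZ)
  have covZ: "finitely_covers G Z A"
    unfolding Z_def by (intro finitely_covers_conj_core assms(7) subB BA order.refl)
  have ZA: "Z \<subseteq> A" by (auto simp: Z_def)
  have ZB: "Z \<subseteq> B"
    unfolding Z_def using A.subset A.one_closed by (rule conj_core_subset)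
  have normZ: "a \<otimes>\<^bsub>G\<^esub> z \<otimes>\<^bsub>G\<^esub> inv\<^bsub>G\<^esub> a \<in> Z" if "a \<in> A" "z \<in> Z" for a z
    using conj_core_invariant[OF assms(7) order.refl assms(7)] that unfolding Z_def by blast

  define D where "D = G\<lparr>carrier := Z\<rparr>"
  have "comm_group D"
    unfolding D_def
  proof (rule group.group_comm_groupI[OF subgroup_imp_group[OF subZ]])
    fix x y assume "x \<in> carrier (G\<lparr>carrier := Z\<rparr>)" "y \<in> carrier (G\<lparr>carrier := Z\<rparr>)"
    then show "x \<otimes>\<^bsub>G\<lparr>carrier := Z\<rparr>\<^esub> y = y \<otimes>\<^bsub>G\<lparr>carrier := Z\<rparr>\<^esub> x"
      using comm_groupE(4)[OF B(2), of x y] ZB by auto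
  qed
  then interpret D: comm_group D .
  have D_simps: "carrier D = Z" "\<one>\<^bsub>D\<^esub> = \<one>\<^bsub>G\<^esub>" "x [^]\<^bsub>D\<^esub> (n::nat) = x [^]\<^bsub>G\<^esub> n" for x n
    by (simp_all add: D_def nat_pow_consistent[symmetric])

  obtain S where S: "finite S" "S \<subseteq> H" "generate G S = H"
    using assms(4) generate_consistent[OF _ assms(3)] unfolding finitely_generated_group_def by auto
  \<comment> \<open>\<open>Z\<close> has finite index in \<open>A\<close>, hence in
    \<open>H\<close>, so Schreier's lemma passes finite generation from \<open>H\<close> to
    \<open>Z\<close>.\<close>
  obtain U where U: "finite U" "U \<subseteq> Z" "generate G U = Z"
  proof (rule finitely_generated_if_finitely_covers[of S Z])
    show "finitely_covers G Z (generate G S)"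
      using finitely_covers_mono[OF covZ order.refl assms(8)] S(3) by simp
  qed (use S ZB BH subZ H.subset in auto)
  have genU: "generate D U = Z" using generate_consistent[OF U(2) subZ] U(3) by (simp add: D_def)

  obtain K0 \<rho> where K0: "finite_index_subgroup K0 G" "H \<subseteq> K0"
    "\<rho> \<in> hom (G\<lparr>carrier := K0\<rparr>) (G\<lparr>carrier := K0, carrier := H\<rparr>)" "\<forall>h\<in>H. \<rho> h = h"
    using assms(6) unfolding virtual_retract_def group_retract_def by blast
  have subK0: "subgroup K0 G" and covK0: "finitely_covers G K0 (carrier G)"
    using K0(1) by (auto simp: finite_index_subgroup_def finite_rcosets_iff_finitely_covers)
  have \<rho>: "\<rho> k \<in> H" "\<rho> (k \<otimes>\<^bsub>G\<^esub> l) = \<rho> k \<otimes>\<^bsub>G\<^esub> \<rho> l" if "k \<in> K0" "l \<in> K0" for k l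
    using K0(3) that by (auto simp: hom_def)
  have \<rho>G: "\<rho> \<in> K0 \<rightarrow> carrier G" using \<rho>(1) by auto
  \<comment> \<open>Restricting to the preimage of \<open>Z\<close> turns \<open>\<rho>\<close> into
    a retraction onto \<open>Z\<close>. The index stays finite because \<open>\<rho>\<close> has
    values in \<open>H\<close>, inside \<open>A\<close>, where \<open>Z\<close> has finitely many
    cosets.\<close>
  define K1 where "K1 = {x \<in> K0. \<rho> x \<in> Z}"
  have subK1: "subgroup K1 G"
    unfolding K1_def by (intro subgroup_vimage subK0 subZ \<rho>G \<rho>(2))
  have "finitely_covers G K1 K0"
    unfolding K1_def
  proof (rule finitely_covers_vimage[OF subK0 subZ \<rho>G \<rho>(2)])
    have "\<rho> ` K0 \<subseteq> A" using \<rho>(1) assms(8) by auto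
    then show "finitely_covers G Z (\<rho> ` K0)" by (rule finitely_covers_mono[OF covZ order.refl])
  qed
  then have covK1: "finitely_covers G K1 (carrier G)"
    using covK0 subgroup.subset[OF subK1] by (rule finitely_covers_trans)
  have ZK1: "Z \<subseteq> K1" using ZB BH K0(2,4) by (auto simp: K1_def)

  \<comment> \<open>The averaging needs a domain normalised by \<open>A\<close>. The core still
    contains \<open>Z\<close>, since \<open>Z\<close> lies in \<open>K1\<close> and is normalised by
    \<open>A\<close>.\<close>
  define K where "K = {x \<in> carrier G. \<forall>a\<in>A. a \<otimes>\<^bsub>G\<^esub> x \<otimes>\<^bsub>G\<^esub> inv\<^bsub>G\<^esub> a \<in> K1}"
  have subK: "subgroup K G"
    unfolding K_def by (intro subgroup_conj_core subgroup_self subK1 A.subset)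
  interpret K: subgroup K G by (fact subK)
  have covK: "finitely_covers G K (carrier G)"
    unfolding K_def by (intro finitely_covers_conj_core subgroup_self subK1 covK1 A.subset)
  have ZK: "Z \<subseteq> K" unfolding K_def using normZ ZK1 Z.subset by blast
  have KK1: "K \<subseteq> K1"
    unfolding K_def using subset_refl A.one_closed by (rule conj_core_subset)
  have normK: "a \<otimes>\<^bsub>G\<^esub> k \<otimes>\<^bsub>G\<^esub> inv\<^bsub>G\<^esub> a \<in> K" if "a \<in> A" "k \<in> K" for a k
    using conj_core_invariant[OF assms(7) A.subset subgroup_self] that unfolding K_def by blast

  obtain \<phi> and m :: nat where m: "m > 0" and \<phi>: "\<And>k. k \<in> K \<Longrightarrow> \<phi> k \<in> Z"
    "\<And>k l. k \<in> K \<Longrightarrow> l \<in> K \<Longrightarrow> \<phi> (k \<otimes>\<^bsub>G\<^esub> l) = \<phi> k \<otimes>\<^bsub>G\<^esub> \<phi> l"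
    "\<And>z. z \<in> Z \<Longrightarrow> \<phi> z = z [^]\<^bsub>G\<^esub> m"
    "\<And>a k. a \<in> A \<Longrightarrow> k \<in> K \<Longrightarrow> \<phi> (a \<otimes>\<^bsub>G\<^esub> k \<otimes>\<^bsub>G\<^esub> inv\<^bsub>G\<^esub> a) = a \<otimes>\<^bsub>G\<^esub> \<phi> k \<otimes>\<^bsub>G\<^esub> inv\<^bsub>G\<^esub> a"
  proof (rule averaged_retraction[OF assms(7) subZ ZA covZ _ _ subK ZK, of \<rho>])
    show "a \<otimes>\<^bsub>G\<^esub> z \<otimes>\<^bsub>G\<^esub> inv\<^bsub>G\<^esub> a \<in> Z" if "a \<in> A" "z \<in> Z" for a z
      using that by (rule normZ)
    show "a \<otimes>\<^bsub>G\<^esub> k \<otimes>\<^bsub>G\<^esub> inv\<^bsub>G\<^esub> a \<in> K" if "a \<in> A" "k \<in> K" for a k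
      using that by (rule normK)
    show "comm_group (G\<lparr>carrier := Z\<rparr>)" using D.comm_group_axioms by (simp add: D_def)
    show "\<rho> k \<in> Z" if "k \<in> K" for k using that KK1 by (auto simp: K1_def)
    show "\<rho> (k \<otimes>\<^bsub>G\<^esub> l) = \<rho> k \<otimes>\<^bsub>G\<^esub> \<rho> l" if "k \<in> K" "l \<in> K" for k l
      using that KK1 \<rho>(2) by (auto simp: K1_def)
    show "\<rho> z = z" if "z \<in> Z" for z using that K0(4) ZB BH by auto
  qed (rule that)
  have \<phi>G: "\<phi> \<in> K \<rightarrow> carrier G" using \<phi>(1) by auto

  \<comment> \<open>The kernel is written as the preimage of the trivial subgroup to fit
    \<open>subgroup_vimage\<close>.\<close>
  define N where "N = {k \<in> K. \<phi> k \<in> {\<one>\<^bsub>G\<^esub>}}"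
  have subN: "subgroup N G"
    unfolding N_def by (intro subgroup_vimage subK triv_subgroup \<phi>G \<phi>(2))
  interpret N: subgroup N G by (fact subN)
  have normN: "a \<otimes>\<^bsub>G\<^esub> n \<otimes>\<^bsub>G\<^esub> inv\<^bsub>G\<^esub> a \<in> N" if "a \<in> A" "n \<in> N" for a n
    using that normK \<phi>(4) by (auto simp: N_def)

  have finite_AN: "finite (A \<inter> N)"
  proof -
    \<comment> \<open>An element of \<open>Z\<close> in the kernel satisfies
      \<open>z [^] m = \<one>\<close>, so it is torsion in a finitely generated abelian
      group.\<close>
    have "Z \<inter> (A \<inter> N) \<subseteq> {x \<in> generate D U. x [^]\<^bsub>D\<^esub> m = \<one>\<^bsub>D\<^esub>}"
      using \<phi>(3) by (auto simp: genU N_def D_simps)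
    moreover have "finite {x \<in> generate D U. x [^]\<^bsub>D\<^esub> m = \<one>\<^bsub>D\<^esub>}"
      using U m by (intro D.finite_torsion_generate) (auto simp: D_simps)
    ultimately have fin: "finite (Z \<inter> (A \<inter> N))" by (rule finite_subset)
    have "finitely_covers G (Z \<inter> (A \<inter> N)) (A \<inter> N)"
      using finitely_covers_mono[OF covZ order.refl] assms(7) subN subZ
      by (intro finitely_covers_Int subgroups_Inter_pair) auto
    then obtain T where T: "finite T" "A \<inter> N \<subseteq> (Z \<inter> (A \<inter> N)) <#>\<^bsub>G\<^esub> T"
      unfolding finitely_covers_def by blast
    have "finite ((Z \<inter> (A \<inter> N)) <#>\<^bsub>G\<^esub> T)" using fin T(1) by (simp add: set_mult_def)
    then show ?thesis using T(2) by (rule rev_finite_subset)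
  qed

  have covZN: "finitely_covers G (Z <#>\<^bsub>G\<^esub> N) (carrier G)"
  proof -
    define P where "P = (\<lambda>w. w [^]\<^bsub>G\<^esub> m) ` Z"
    have P: "P = (\<lambda>w. w [^]\<^bsub>D\<^esub> m) ` carrier D" by (simp add: P_def D_simps)
    have "subgroup P D" unfolding P by (rule D.subgroup_powers)
    then have subP: "subgroup P G" using incl_subgroup[OF subZ, of P] by (simp add: D_def)
    have "finitely_covers D P Z"
      using D.finitely_covers_powers[OF U(1) _ m] U(2) genU by (simp add: P D_simps)
    then have "finitely_covers G P Z"
      unfolding D_def finitely_covers_carrier_update using Z.subset by (auto simp: finitely_covers_def)
    then have "finitely_covers G P (\<phi> ` K)" using \<phi>(1) by (blast intro: finitely_covers_mono)
    then have covP: "finitely_covers G {k \<in> K. \<phi> k \<in> P} K"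
      by (intro finitely_covers_vimage subK subP \<phi>G \<phi>(2))
    \<comment> \<open>If \<open>\<phi> k\<close> is the \<open>m\<close>-th power of
      \<open>w\<close> in \<open>Z\<close>, it equals \<open>\<phi> w\<close>, so \<open>k\<close>
      differs from \<open>w\<close> by an element of the kernel.\<close>
    have "{k \<in> K. \<phi> k \<in> P} \<subseteq> Z <#>\<^bsub>G\<^esub> N"
    proof
      fix k assume "k \<in> {k \<in> K. \<phi> k \<in> P}"
      then obtain w where k: "k \<in> K" and w: "w \<in> Z" "\<phi> k = \<phi> w" using \<phi>(3) by (auto simp: P_def)
      define n where "n = inv\<^bsub>G\<^esub> w \<otimes>\<^bsub>G\<^esub> k"
      have wK: "w \<in> K" using w ZK by auto
      then have n: "n \<in> K" using k by (simp add: n_def)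
      have kn: "k = w \<otimes>\<^bsub>G\<^esub> n" using k w by (simp add: n_def group_word_simps)
      then have "\<phi> w = \<phi> w \<otimes>\<^bsub>G\<^esub> \<phi> n" using \<phi>(2)[OF wK n] w(2) by simp
      moreover have "\<phi> w \<in> carrier G" "\<phi> n \<in> carrier G" using \<phi>G wK n by auto
      ultimately have "\<phi> n = \<one>\<^bsub>G\<^esub>" using l_cancel_one' by metis
      then have "n \<in> N" using n by (simp add: N_def)
      then show "k \<in> Z <#>\<^bsub>G\<^esub> N" using kn w unfolding set_mult_def by blast
    qed
    then have "finitely_covers G (Z <#>\<^bsub>G\<^esub> N) K" using finitely_covers_mono[OF covP] by blast
    then show ?thesis
      using covK set_mult_closed[OF Z.subset N.subset] by (rule finitely_covers_trans)
  qed

  obtain M where M: "M \<lhd> G" "finitely_covers G M (carrier G)" "M \<inter> (A \<inter> N) \<subseteq> {\<one>\<^bsub>G\<^esub>}"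
    by (rule residually_finite_avoids_finite[OF assms(2) finite_AN]) auto
  have subM: "subgroup M G" using M(1) by (rule normal_imp_subgroup)
  have subMN: "subgroup (M \<inter> N) G" using subM subN by (rule subgroups_Inter_pair)
  show ?thesis
  proof (rule virtual_retract_complement[OF assms(7) subMN])
    show "a \<otimes>\<^bsub>G\<^esub> n \<otimes>\<^bsub>G\<^esub> inv\<^bsub>G\<^esub> a \<in> M \<inter> N" if "a \<in> A" "n \<in> M \<inter> N" for a n
      using that normN M(1) by (auto simp: normal_inv_iff)
    show "A \<inter> (M \<inter> N) \<subseteq> {\<one>\<^bsub>G\<^esub>}" using M(3) by auto
    have "finitely_covers G (M \<inter> N) N"
      using finitely_covers_mono[OF M(2) order.refl N.subset] by (intro finitely_covers_Int subN subM)
    then obtain T where T: "finite T" "T \<subseteq> carrier G" "N \<subseteq> (M \<inter> N) <#>\<^bsub>G\<^esub> T"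
      unfolding finitely_covers_def by blast
    \<comment> \<open>Shrinking \<open>N\<close> to \<open>M \<inter> N\<close> costs only the
      finite set \<open>T\<close>, so finite index of \<open>A <#> (M \<inter> N)\<close> follows
      from that of \<open>Z <#> N\<close>.\<close>
    have "Z <#>\<^bsub>G\<^esub> N \<subseteq> A <#>\<^bsub>G\<^esub> ((M \<inter> N) <#>\<^bsub>G\<^esub> T)" using ZA T(3) by (rule mono_set_mult)
    also have "\<dots> = (A <#>\<^bsub>G\<^esub> (M \<inter> N)) <#>\<^bsub>G\<^esub> T"
      using set_mult_assoc[OF A.subset subgroup.subset[OF subMN] T(2)] by simp
    finally have "finitely_covers G (A <#>\<^bsub>G\<^esub> (M \<inter> N)) (Z <#>\<^bsub>G\<^esub> N)"
      using T(1,2) unfolding finitely_covers_def by blast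
    then show "finitely_covers G (A <#>\<^bsub>G\<^esub> (M \<inter> N)) (carrier G)"
      using covZN set_mult_closed[OF A.subset subgroup.subset[OF subMN]] by (rule finitely_covers_trans)
  qed
qed

end
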